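(* The function $(\kappa,\rho)\mapsto\lambda_{\max}(\kappa,\rho)$ maps $W$ to $[1,\infty)$. Let $(\kappa,\rho)\in W$, and consider $(m_{-\infty},m_\infty,n_{-\infty},n_\infty)\in\mathbb{R}^4$ with $m_{-\infty}<m_\infty$ and $n_\infty<n_{-\infty}$. An element of $\mathrm{ABMN}(\kappa,\rho)$ exists with this boundary data quadruple if and only if $$\frac{n_{-\infty}-n_\infty}{m_\infty-m_{-\infty}}\in\big[\lambda_{\max}(\kappa,\rho)^{-1},\lambda_{\max}(\kappa,\rho)\big].$$
   Context: $W=\{(\kappa,\rho)\in(0,1]\times(0,\infty):\rho^2\kappa\le1\}$. $\mathrm{ABMN}(\kappa,\rho)$ is the set of sequences $(a_i,b_i,m_i,n_i)_{i\in\mathbb{Z}}$ with values in $(0,\infty)^2\times\mathbb{R}^2$ satisfying, for every $i\in\mathbb{Z}$, $$2(a_i^\rho+b_i^\rho)(m_i+a_i)=\big(a_i^\rho(1-\kappa)+b_i^\rho(1+\kappa)\big)m_{i-1}+\big(a_i^\rho(1+\kappa)+b_i^\rho(1-\kappa)\big)m_{i+1},$$ $$2(a_i^\rho+b_i^\rho)(n_i+b_i)=\big(a_i^\rho(1-\kappa)+b_i^\rho(1+\kappa)\big)n_{i-1}+\big(a_i^\rho(1+\kappa)+b_i^\rho(1-\kappa)\big)n_{i+1},$$ $$(a_i^\rho+b_i^\rho)^2=\rho\kappa\,a_i^{\rho-1}b_i^\rho\,(m_{i+1}-m_{i-1}),\qquad (a_i^\rho+b_i^\rho)^2=\rho\kappa\,a_i^{\rho}b_i^{\rho-1}\,(n_{i-1}-n_{i+1}).$$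 An element has boundary data $(m_{-\infty},m_\infty,n_{-\infty},n_\infty)$ if $m_{-k}\to m_{-\infty}$, $m_k\to m_\infty$, $n_{-k}\to n_{-\infty}$, $n_k\to n_\infty$ as $k\to\infty$. (For $(\kappa,\rho)\in W$ these limits exist and are finite, with $m_{-\infty}<m_\infty$ and $n_\infty<n_{-\infty}$, for every element of $\mathrm{ABMN}(\kappa,\rho)$.) For $(\kappa,\rho)\in W$, $$\lambda_{\max}(\kappa,\rho)=\sup\Big\{\frac{n_{-\infty}-n_\infty}{m_\infty-m_{-\infty}}:(a,b,m,n)\in\mathrm{ABMN}(\kappa,\rho)\Big\}.$$ *)

theory Defs
  imports "HOL-Analysis.Analysis"
begin

definition W_region :: "(real \<times> real) set" where
  "W_region = {(\<kappa>, \<rho>). 0 < \<kappa> \<and> \<kappa> \<le> 1 \<and> 0 < \<rho> \<and> \<rho>\<^sup>2 * \<kappa> \<le> 1}"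

text \<open>A sequence $(a_i,b_i,m_i,n_i)_{i \in \mathbb{Z}}$ is represented by its four coordinate
  sequences \<open>int \<Rightarrow> real\<close>.  Every \<open>powr\<close> has a positive base, so it is the ordinary real power.\<close>

type_synonym abmn_seq = "(int \<Rightarrow> real) \<times> (int \<Rightarrow> real) \<times> (int \<Rightarrow> real) \<times> (int \<Rightarrow> real)"

definition ABMN :: "real \<Rightarrow> real \<Rightarrow> abmn_seq set" where
  "ABMN \<kappa> \<rho> = {(a, b, m, n). \<forall>i.
      0 < a i \<and> 0 < b i \<and>
      2 * (a i powr \<rho> + b i powr \<rho>) * (m i + a i) =
        (a i powr \<rho> * (1 - \<kappa>) + b i powr \<rho> * (1 + \<kappa>)) * m (i - 1) +
        (a i powr \<rho> * (1 + \<kappa>) + b i powr \<rho> * (1 - \<kappa>)) * m (i + 1) \<and>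
      2 * (a i powr \<rho> + b i powr \<rho>) * (n i + b i) =
        (a i powr \<rho> * (1 - \<kappa>) + b i powr \<rho> * (1 + \<kappa>)) * n (i - 1) +
        (a i powr \<rho> * (1 + \<kappa>) + b i powr \<rho> * (1 - \<kappa>)) * n (i + 1) \<and>
      (a i powr \<rho> + b i powr \<rho>)\<^sup>2 =
        \<rho> * \<kappa> * a i powr (\<rho> - 1) * b i powr \<rho> * (m (i + 1) - m (i - 1)) \<and>
      (a i powr \<rho> + b i powr \<rho>)\<^sup>2 =
        \<rho> * \<kappa> * a i powr \<rho> * b i powr (\<rho> - 1) * (n (i - 1) - n (i + 1))}"

text \<open>The quadruple is ordered as $(m_{-\infty}, m_\infty, n_{-\infty}, n_\infty)$.\<close>

definition has_boundary_data :: "abmn_seq \<Rightarrow> real \<times> real \<times> real \<times> real \<Rightarrow> bool" where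
  "has_boundary_data = (\<lambda>(a, b, m, n) (m_minus, m_plus, n_minus, n_plus).
      (\<lambda>k. m (- int k)) \<longlonglongrightarrow> m_minus \<and> (\<lambda>k. m (int k)) \<longlonglongrightarrow> m_plus \<and>
      (\<lambda>k. n (- int k)) \<longlonglongrightarrow> n_minus \<and> (\<lambda>k. n (int k)) \<longlonglongrightarrow> n_plus)"

text \<open>The supremum is taken in the extended reals, so that finiteness and nonemptiness of the
  index set are not built into the definition: it is \<open>\<infinity>\<close> for an unbounded set of ratios and
  \<open>-\<infinity>\<close> for an empty one.\<close>

definition lambda_max :: "real \<Rightarrow> real \<Rightarrow> ereal" where
  "lambda_max \<kappa> \<rho> = Sup {ereal ((n_minus - n_plus) / (m_plus - m_minus)) |
      s m_minus m_plus n_minus n_plus.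
      s \<in> ABMN \<kappa> \<rho> \<and> has_boundary_data s (m_minus, m_plus, n_minus, n_plus)}"

end

theory Submission
  imports Defs
begin

text \<open>Put $t_i = \ln(b_i/a_i)$.  The four equations at $i$ express the increments of $m$ and $n$ on
  both sides of $i$ as $a_i$, $b_i$ times explicit functions of $t_i$.  Matching the ratio of the
  $n$- to the $m$-increment across the edge between $i$ and $i+1$ gives
  $\Delta(t_{i+1}) = -\Delta(-t_i)$, and $\rho^2\kappa \le 1$ makes $\Delta$ an increasing bijection of
  $\mathbb{R}$.  Hence $t_{i+1} = S(t_i)$ for a map $S$ without fixed points, and up to scaling and
  translation there is exactly one solution for each $t_0$.  The ratio of its boundary gaps is a
  continuous function $\Lambda(t_0)$, with $\Lambda \circ S = \Lambda$ (shift of indices) and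
  $\Lambda(-t) = 1/\Lambda(t)$ (reflection of indices, exchanging the two players).  So
  $\Lambda(\mathbb{R}) = \Lambda([S(0), -S(0)])$ is a compact interval, closed under inversion.\<close>

section \<open>Summation over the integers and the algebra at a single index\<close>

lemma antidifference_exists:
  fixes f :: "int \<Rightarrow> real"
  shows "\<exists>F. \<forall>i. F (i + 1) - F i = f i"
proof (intro exI allI)
  fix i :: int
  \<comment> \<open>This is the signed sum from 0 to i: at least one of the two index intervals is
    empty, and stepping from i to i + 1 adds f i to the first sum or removes it from the
    second.\<close>
  define F where "F i = sum f {0..<i} - sum f {i..<0}" for i
  show "F (i + 1) - F i = f i"
  proof (cases "0 \<le> i")
    case True
    then have "{0..<i + 1} = insert i {0..<i}" "{i + 1..<0} = {}" "{i..<0} = {}"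
      by auto
    then show ?thesis
      by (simp add: F_def)
  next
    case False
    then have "{i..<0} = insert i {i + 1..<0}" "{0..<i + 1} = {}" "{0..<i} = {}"
      by auto
    then show ?thesis
      by (simp add: F_def)
  qed
qed

text \<open>After denominators are cleared, the two equations are linear in the increments on either
  side of \<open>m\<^sub>1\<close>, with nonzero determinant \<open>2 * h * x * y * (x + y)\<close>.
  In the application x and y are \<open>a powr \<rho>\<close> and \<open>b powr \<rho>\<close>, so
  that \<open>x / a\<close> is \<open>a powr (\<rho> - 1)\<close>, and h is
  \<open>\<rho> * \<kappa>\<close>.\<close>

lemma tug_equations_iff:
  fixes x y a h k m\<^sub>0 m\<^sub>1 m\<^sub>2 :: real
  assumes pos: "x > 0" "y > 0" "a > 0" "h > 0"
  shows "2 * (x + y) * (m\<^sub>1 + a) = (x * (1 - k) + y * (1 + k)) * m\<^sub>0 + (x * (1 + k) + y * (1 - k)) * m\<^sub>2 \<and>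
      (x + y)\<^sup>2 = h * (x / a) * y * (m\<^sub>2 - m\<^sub>0) \<longleftrightarrow>
    m\<^sub>2 - m\<^sub>1 = a * (((1 - k) * (x / y) + 2 * (1 + h) + (1 + k) * (y / x)) / (2 * h)) \<and>
      m\<^sub>1 - m\<^sub>0 = a * (((1 + k) * (x / y) + 2 * (1 - h) + (1 - k) * (y / x)) / (2 * h))"
proof -
  define u v where "u = m\<^sub>2 - m\<^sub>1" and "v = m\<^sub>1 - m\<^sub>0"
  have m: "m\<^sub>2 = m\<^sub>1 + u" "m\<^sub>0 = m\<^sub>1 - v"
    by (simp_all add: u_def v_def)
  have e1: "2 * (x + y) * (m\<^sub>1 + a) =
      (x * (1 - k) + y * (1 + k)) * m\<^sub>0 + (x * (1 + k) + y * (1 - k)) * m\<^sub>2 \<longleftrightarrow>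
      2 * (x + y) * a = (x * (1 + k) + y * (1 - k)) * u - (x * (1 - k) + y * (1 + k)) * v"
    unfolding m by (auto simp: algebra_simps)
  have e2: "(x + y)\<^sup>2 = h * (x / a) * y * (m\<^sub>2 - m\<^sub>0) \<longleftrightarrow> a * (x + y)\<^sup>2 = h * x * y * (u + v)"
    unfolding m using pos by (auto simp: field_simps)
  have e3: "u = a * (((1 - k) * (x / y) + 2 * (1 + h) + (1 + k) * (y / x)) / (2 * h)) \<longleftrightarrow>
      2 * h * x * y * u = a * ((1 - k) * x\<^sup>2 + 2 * (1 + h) * x * y + (1 + k) * y\<^sup>2)"
    using pos by (auto simp: field_simps power2_eq_square)
  have e4: "v = a * (((1 + k) * (x / y) + 2 * (1 - h) + (1 - k) * (y / x)) / (2 * h)) \<longleftrightarrow>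
      2 * h * x * y * v = a * ((1 + k) * x\<^sup>2 + 2 * (1 - h) * x * y + (1 - k) * y\<^sup>2)"
    using pos by (auto simp: field_simps power2_eq_square)
  have "2 * (x + y) * a = (x * (1 + k) + y * (1 - k)) * u - (x * (1 - k) + y * (1 + k)) * v \<and>
      a * (x + y)\<^sup>2 = h * x * y * (u + v) \<longleftrightarrow>
    2 * h * x * y * u = a * ((1 - k) * x\<^sup>2 + 2 * (1 + h) * x * y + (1 + k) * y\<^sup>2) \<and>
      2 * h * x * y * v = a * ((1 + k) * x\<^sup>2 + 2 * (1 - h) * x * y + (1 - k) * y\<^sup>2)"
    (is "?E1 \<and> ?E2 \<longleftrightarrow> ?U \<and> ?V")
  proof
    assume E: "?E1 \<and> ?E2"
    \<comment> \<open>Eliminating one of the increments leaves the positive factor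
      \<open>x + y\<close>, which is cancelled afterwards.\<close>
    have "(x + y) * (2 * h * x * y * u) =
        (x + y) * (a * ((1 - k) * x\<^sup>2 + 2 * (1 + h) * x * y + (1 + k) * y\<^sup>2))"
      using E by algebra
    moreover have "(x + y) * (2 * h * x * y * v) =
        (x + y) * (a * ((1 + k) * x\<^sup>2 + 2 * (1 - h) * x * y + (1 - k) * y\<^sup>2))"
      using E by algebra
    moreover have "x + y \<noteq> 0"
      using pos by simp
    ultimately show "?U \<and> ?V"
      by simp
  next
    assume E: "?U \<and> ?V"
    have "(2 * h * x * y) * (2 * (x + y) * a) =
        (2 * h * x * y) * ((x * (1 + k) + y * (1 - k)) * u - (x * (1 - k) + y * (1 + k)) * v)"
      using E by algebra
    moreover have "2 * h * x * y \<noteq> 0"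
      using pos by simp
    ultimately have ?E1
      by (subst (asm) mult_cancel_left) blast
    moreover have ?E2
      using E by algebra
    ultimately show "?E1 \<and> ?E2" ..
  qed
  then show ?thesis
    unfolding e1 e2 e3[unfolded u_def] e4[unfolded v_def] u_def v_def by (simp only:)
qed

section \<open>The four equations as increments of m and n\<close>

locale abmn =
  fixes \<kappa> \<rho> :: real
  assumes W: "(\<kappa>, \<rho>) \<in> W_region"
begin

lemma params: "0 < \<kappa>" "\<kappa> \<le> 1" "0 < \<rho>" "\<rho>\<^sup>2 * \<kappa> \<le> 1"
  using W by (auto simp: W_region_def)

text \<open>The upper bound keeps the constant term \<open>2 * (1 - \<rho> * \<kappa>)\<close> of
  \<open>\<nu>\<close> nonnegative, and hence \<open>\<nu>\<close> positive.\<close>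

lemma \<rho>\<kappa>_pos: "0 < \<rho> * \<kappa>" and \<rho>\<kappa>_le_1: "\<rho> * \<kappa> \<le> 1"
proof -
  show "0 < \<rho> * \<kappa>"
    using params by simp
  have "(\<rho> * \<kappa>)\<^sup>2 = \<rho>\<^sup>2 * \<kappa> * \<kappa>"
    by (simp add: power2_eq_square)
  also have "\<dots> \<le> 1 * 1"
    using params by (intro mult_mono) auto
  finally show "\<rho> * \<kappa> \<le> 1"
    using power2_le_imp_le[of "\<rho> * \<kappa>" 1] by simp
qed

text \<open>At t = t_i, \<open>\<nu>\<close> and \<open>\<mu>\<close> are the increments of m before
  and after i in units of a_i; at -t_i they are the decrements of n after and before i in units of
  b_i.\<close>

definition \<nu> :: "real \<Rightarrow> real" where
  "\<nu> t = ((1 + \<kappa>) * exp (- \<rho> * t) + 2 * (1 - \<rho> * \<kappa>) + (1 - \<kappa>) * exp (\<rho> * t)) / (2 * (\<rho> * \<kappa>))"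

definition \<mu> :: "real \<Rightarrow> real" where
  "\<mu> t = \<nu> (- t) + 2"

lemma \<mu>_altdef:
  "\<mu> t = ((1 - \<kappa>) * exp (- \<rho> * t) + 2 * (1 + \<rho> * \<kappa>) + (1 + \<kappa>) * exp (\<rho> * t)) / (2 * (\<rho> * \<kappa>))"
  using \<rho>\<kappa>_pos params by (simp add: \<mu>_def \<nu>_def field_simps)

lemma \<nu>_pos: "0 < \<nu> t"
proof -
  have "0 < (1 + \<kappa>) * exp (- \<rho> * t)" "0 \<le> (1 - \<kappa>) * exp (\<rho> * t)"
    using params by auto
  then show ?thesis
    unfolding \<nu>_def using \<rho>\<kappa>_pos \<rho>\<kappa>_le_1
    by (intro divide_pos_pos add_pos_nonneg) simp_all
qed

lemma \<mu>_pos: "0 < \<mu> t"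
  using \<nu>_pos[of "- t"] by (simp add: \<mu>_def)

lemma continuous_\<nu>: "continuous_on A \<nu>"
  unfolding \<nu>_def using params by (intro continuous_intros) auto

lemma continuous_\<mu>: "continuous_on A \<mu>"
  unfolding \<mu>_altdef using params by (intro continuous_intros) auto

lemma ABMN_iff_steps:
  "(a, b, m, n) \<in> ABMN \<kappa> \<rho> \<longleftrightarrow> (\<forall>i. 0 < a i \<and> 0 < b i \<and>
     m (i + 1) - m i = a i * \<mu> (ln (b i / a i)) \<and> m i - m (i - 1) = a i * \<nu> (ln (b i / a i)) \<and>
     n (i - 1) - n i = b i * \<mu> (- ln (b i / a i)) \<and> n i - n (i + 1) = b i * \<nu> (- ln (b i / a i)))"
proof -
  have "0 < x \<and> 0 < y \<and>
      2 * (x powr \<rho> + y powr \<rho>) * (m i + x) =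
        (x powr \<rho> * (1 - \<kappa>) + y powr \<rho> * (1 + \<kappa>)) * m (i - 1) +
        (x powr \<rho> * (1 + \<kappa>) + y powr \<rho> * (1 - \<kappa>)) * m (i + 1) \<and>
      2 * (x powr \<rho> + y powr \<rho>) * (n i + y) =
        (x powr \<rho> * (1 - \<kappa>) + y powr \<rho> * (1 + \<kappa>)) * n (i - 1) +
        (x powr \<rho> * (1 + \<kappa>) + y powr \<rho> * (1 - \<kappa>)) * n (i + 1) \<and>
      (x powr \<rho> + y powr \<rho>)\<^sup>2 =
        \<rho> * \<kappa> * x powr (\<rho> - 1) * y powr \<rho> * (m (i + 1) - m (i - 1)) \<and>
      (x powr \<rho> + y powr \<rho>)\<^sup>2 =
        \<rho> * \<kappa> * x powr \<rho> * y powr (\<rho> - 1) * (n (i - 1) - n (i + 1)) \<longleftrightarrow>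
    0 < x \<and> 0 < y \<and>
      m (i + 1) - m i = x * \<mu> (ln (y / x)) \<and> m i - m (i - 1) = x * \<nu> (ln (y / x)) \<and>
      n (i - 1) - n i = y * \<mu> (- ln (y / x)) \<and> n i - n (i + 1) = y * \<nu> (- ln (y / x))"
    for x y :: real and i :: int
  proof (cases "0 < x \<and> 0 < y")
    case True
    then have pos: "0 < x" "0 < y"
      by auto
    define X Y where "X = x powr \<rho>" and "Y = y powr \<rho>"
    have XY: "0 < X" "0 < Y"
      using pos by (auto simp: X_def Y_def)
    define t where "t = ln (y / x)"
    have "exp (\<rho> * t) = Y / X" "exp (- \<rho> * t) = X / Y"
      using pos by (simp_all add: t_def X_def Y_def powr_def ln_div exp_diff right_diff_distrib)
    then have \<mu>\<nu>:
      "((1 - \<kappa>) * (X / Y) + 2 * (1 + \<rho> * \<kappa>) + (1 + \<kappa>) * (Y / X)) / (2 * (\<rho> * \<kappa>)) = \<mu> t"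
      "((1 + \<kappa>) * (X / Y) + 2 * (1 - \<rho> * \<kappa>) + (1 - \<kappa>) * (Y / X)) / (2 * (\<rho> * \<kappa>)) = \<nu> t"
      "((1 - \<kappa>) * (Y / X) + 2 * (1 + \<rho> * \<kappa>) + (1 + \<kappa>) * (X / Y)) / (2 * (\<rho> * \<kappa>)) = \<mu> (- t)"
      "((1 + \<kappa>) * (Y / X) + 2 * (1 - \<rho> * \<kappa>) + (1 - \<kappa>) * (X / Y)) / (2 * (\<rho> * \<kappa>)) = \<nu> (- t)"
      by (simp_all add: \<mu>_altdef \<nu>_def)
    have p: "x powr (\<rho> - 1) = X / x" "y powr (\<rho> - 1) = Y / y"
      using pos by (simp_all add: X_def Y_def powr_diff)
    note c1 = tug_equations_iff[OF XY pos(1) \<rho>\<kappa>_pos, of "m i" \<kappa> "m (i - 1)" "m (i + 1)", unfolded \<mu>\<nu>]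
    \<comment> \<open>For n the players trade places and the neighbours i - 1 and i + 1 are swapped,
      so the same lemma applies; \<open>n1\<close> and \<open>n2\<close> only reorder terms.\<close>
    note c2 = tug_equations_iff[OF XY(2,1) pos(2) \<rho>\<kappa>_pos, of "n i" \<kappa> "n (i + 1)" "n (i - 1)", unfolded \<mu>\<nu>]
    have n1: "2 * (X + Y) * (n i + y) =
          (X * (1 - \<kappa>) + Y * (1 + \<kappa>)) * n (i - 1) + (X * (1 + \<kappa>) + Y * (1 - \<kappa>)) * n (i + 1) \<longleftrightarrow>
        2 * (Y + X) * (n i + y) =
          (Y * (1 - \<kappa>) + X * (1 + \<kappa>)) * n (i + 1) + (Y * (1 + \<kappa>) + X * (1 - \<kappa>)) * n (i - 1)"
      by (simp add: add_ac)
    have n2: "(X + Y)\<^sup>2 = \<rho> * \<kappa> * X * (Y / y) * (n (i - 1) - n (i + 1)) \<longleftrightarrow>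
        (Y + X)\<^sup>2 = \<rho> * \<kappa> * (Y / y) * X * (n (i - 1) - n (i + 1))"
      by (simp add: add_ac mult_ac)
    show ?thesis
      unfolding p X_def[symmetric] Y_def[symmetric] t_def[symmetric] n1 n2
      using c1 c2 True by blast
  qed auto
  then show ?thesis
    by (simp add: ABMN_def)
qed

section \<open>The increasing bijection \<Delta>\<close>

text \<open>At t = t_i this is the logarithm of (n_{i-1} - n_i)/(m_i - m_{i-1}), because
  \<open>\<mu> (- t) = \<nu> t + 2\<close>.\<close>

definition \<Delta> :: "real \<Rightarrow> real" where
  "\<Delta> t = t + ln (\<nu> t + 2) - ln (\<nu> t)"

lemma exp_\<Delta>: "exp (\<Delta> t) = exp t * \<mu> (- t) / \<nu> t"
  using \<nu>_pos[of t] by (simp add: \<Delta>_def \<mu>_def exp_add exp_diff)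

lemma \<Delta>_gt: "t < \<Delta> t"
  using \<nu>_pos[of t] by (simp add: \<Delta>_def)

lemma continuous_\<Delta>: "continuous_on A \<Delta>"
proof -
  have "\<nu> t \<noteq> 0" "\<nu> t + 2 \<noteq> 0" for t
    using \<nu>_pos[of t] by auto
  then show ?thesis
    unfolding \<Delta>_def by (intro continuous_intros continuous_\<nu>) auto
qed

text \<open>Over a common denominator, the derivative has the sign of
  \<open>\<nu> x * (\<nu> x + 2) - 2 * \<nu>'\<close>.\<close>

lemma strict_mono_\<Delta>: "strict_mono \<Delta>"
proof (rule strict_monoI)
  fix s t :: real
  assume "s < t"
  show "\<Delta> s < \<Delta> t"
  proof (rule DERIV_pos_imp_increasing[OF \<open>s < t\<close>])
    fix x
    define U V where "U = (1 + \<kappa>) * exp (- \<rho> * x)" and "V = (1 - \<kappa>) * exp (\<rho> * x)"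
    have UV: "0 < U" "0 \<le> V"
      using params by (auto simp: U_def V_def)
    define \<nu>' where "\<nu>' = (V - U) / (2 * \<kappa>)"
    have \<nu>': "(\<nu> has_real_derivative \<nu>') (at x)"
      unfolding \<nu>_def \<nu>'_def U_def V_def using params
      by (auto intro!: derivative_eq_intros simp: field_simps)
    have \<nu>: "\<nu> x = (U + V + 2 - 2 * (\<rho> * \<kappa>)) / (2 * (\<rho> * \<kappa>))"
      by (simp add: \<nu>_def U_def V_def algebra_simps)
    have "(\<Delta> has_real_derivative 1 + \<nu>' / (\<nu> x + 2) - \<nu>' / \<nu> x) (at x)"
      unfolding \<Delta>_def using \<nu>_pos[of x]
      by (auto intro!: derivative_eq_intros \<nu>' simp: field_simps)
    moreover have "0 < 1 + \<nu>' / (\<nu> x + 2) - \<nu>' / \<nu> x"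
    proof -
      have \<kappa>: "\<rho>\<^sup>2 * \<kappa> * \<kappa> \<le> 1 * 1"
        using params by (intro mult_mono) auto
      have "0 \<le> V * (1 - \<rho>\<^sup>2 * \<kappa>)" "0 < U * (1 + \<rho>\<^sup>2 * \<kappa>)"
        using UV params by (auto intro!: mult_pos_pos add_pos_pos)
      \<comment> \<open>This is that numerator times
        \<open>(2 * (\<rho> * \<kappa>))\<^sup>2\<close>, sorted by U and V. The hypothesis
        \<open>\<rho>\<^sup>2 * \<kappa> \<le> 1\<close> is exactly nonnegativity of the factor
        multiplying V; the U-term makes the sum strictly positive.\<close>
      then have "0 < (U + V)\<^sup>2 + 4 * (U * (1 + \<rho>\<^sup>2 * \<kappa>)) + 4 * (V * (1 - \<rho>\<^sup>2 * \<kappa>)) + 4 * (1 - \<rho>\<^sup>2 * \<kappa> * \<kappa>)"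
        using \<kappa> by (intro add_pos_nonneg add_nonneg_pos) auto
      also have "\<dots> = (U + V + 2)\<^sup>2 - 4 * (\<rho> * \<kappa>)\<^sup>2 - 4 * \<rho>\<^sup>2 * \<kappa> * (V - U)"
        by algebra
      also have "\<dots> = (2 * (\<rho> * \<kappa>))\<^sup>2 * (\<nu> x * (\<nu> x + 2) - 2 * \<nu>')"
        unfolding \<nu> \<nu>'_def using params by (simp add: field_simps power2_eq_square)
      finally have "0 < \<nu> x * (\<nu> x + 2) - 2 * \<nu>'"
        by (simp add: zero_less_mult_iff)
      then have "0 < (\<nu> x * (\<nu> x + 2) - 2 * \<nu>') / (\<nu> x * (\<nu> x + 2))"
        using \<nu>_pos[of x] by simp
      also have "\<dots> = 1 + \<nu>' / (\<nu> x + 2) - \<nu>' / \<nu> x"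
        using \<nu>_pos[of x] by (simp add: field_simps)
      finally show ?thesis .
    qed
    ultimately show "\<exists>y. (\<Delta> has_real_derivative y) (at x) \<and> 0 < y"
      by blast
  qed
qed

text \<open>For nonpositive t the term \<open>exp (- \<rho> * t)\<close> forces
  \<open>\<nu> t\<close> to be at least 1/2, so (\<nu> + 2)/\<nu> is at most 5. This drives \<Delta>
  to minus infinity on the left, as surjectivity requires.\<close>

lemma \<Delta>_le: "\<Delta> t \<le> t + ln 5" if "t \<le> 0"
proof -
  have "\<rho> * t \<le> 0"
    using that params by (simp add: mult_nonneg_nonpos)
  then have "1 \<le> exp (- \<rho> * t)"
    by simp
  moreover have "0 \<le> \<kappa> * exp (- \<rho> * t)" "0 \<le> (1 - \<kappa>) * exp (\<rho> * t)"
    using params by auto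
  moreover have "0 \<le> 2 * (1 - \<rho> * \<kappa>)"
    using \<rho>\<kappa>_le_1 by simp
  ultimately have "1 \<le> exp (- \<rho> * t) + \<kappa> * exp (- \<rho> * t) + 2 * (1 - \<rho> * \<kappa>) + (1 - \<kappa>) * exp (\<rho> * t)"
    by (smt (verit))
  then have "1 \<le> (1 + \<kappa>) * exp (- \<rho> * t) + 2 * (1 - \<rho> * \<kappa>) + (1 - \<kappa>) * exp (\<rho> * t)"
    by (simp add: distrib_right)
  then have "2 \<le> 4 * \<nu> t"
    unfolding \<nu>_def using \<rho>\<kappa>_pos \<rho>\<kappa>_le_1 by (simp add: field_simps)
  then have "ln (\<nu> t + 2) \<le> ln (5 * \<nu> t)"
    using \<nu>_pos[of t] by simp
  then show ?thesis
    using \<nu>_pos[of t] by (simp add: \<Delta>_def ln_mult)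
qed

lemma bij_\<Delta>: "bij \<Delta>"
proof -
  have "\<exists>x. \<Delta> x = y" for y
  proof -
    \<comment> \<open>The left end is nonpositive so that \<open>\<Delta>_le\<close> applies, and
      low enough that l + ln 5 is at most y. The right end can be y itself, since \<Delta> lies
      above the identity.\<close>
    define l where "l = min 0 (y - ln 5)"
    have "\<Delta> l \<le> y"
      using \<Delta>_le[of l] by (simp add: l_def)
    moreover have "y \<le> \<Delta> y"
      using \<Delta>_gt less_imp_le by blast
    moreover have "l \<le> y"
      using ln_ge_zero[of 5] unfolding l_def by linarith
    ultimately show ?thesis
      using IVT'[of \<Delta> l y y] continuous_\<Delta> by blast
  qed
  then have "surj \<Delta>"
    by (metis surjI)
  then show ?thesis
    using strict_mono_\<Delta> by (simp add: bij_def strict_mono_imp_inj_on)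
qed

section \<open>The map S and its orbits\<close>

definition S :: "real \<Rightarrow> real" where
  "S t = inv \<Delta> (- \<Delta> (- t))"

lemma \<Delta>_S: "\<Delta> (S t) = - \<Delta> (- t)"
  unfolding S_def using bij_\<Delta> by (simp add: bij_is_surj surj_f_inv_f)

lemma S_eqI: "S t = u" if "\<Delta> u = - \<Delta> (- t)"
  unfolding S_def that[symmetric] using bij_\<Delta> by (simp add: bij_is_inj)

text \<open>Negation conjugates S to its inverse, reflecting the reversal of indices. This gives
  surjectivity of S and its backward orbits.\<close>

lemma S_uminus_S: "S (- S t) = - t"
  by (rule S_eqI) (simp add: \<Delta>_S)

text \<open>\<Delta> lies above the identity, so
  \<open>- \<Delta> (- t) < t < \<Delta> t\<close>.\<close>

lemma S_less: "S t < t"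
proof -
  have "\<Delta> (S t) < \<Delta> t"
    using \<Delta>_gt[of t] \<Delta>_gt[of "- t"] by (simp add: \<Delta>_S)
  then show ?thesis
    using strict_mono_\<Delta> strict_mono_less by blast
qed

lemma mono_S: "mono S"
proof (rule monoI)
  fix x y :: real
  assume "x \<le> y"
  then have "\<Delta> (S x) \<le> \<Delta> (S y)"
    using strict_mono_\<Delta> by (simp add: \<Delta>_S strict_mono_less_eq)
  then show "S x \<le> S y"
    using strict_mono_\<Delta> strict_mono_less_eq by blast
qed

lemma surj_S: "surj S"
  by (rule surjI[of _ "\<lambda>t. - S (- t)"]) (use S_uminus_S[of "- _"] in simp)

text \<open>A monotone function with open range has no jumps; this avoids any discussion of
  continuity of \<open>inv \<Delta>\<close>.\<close>

lemma continuous_S: "continuous_on UNIV S"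
proof (rule continuous_onI_mono)
  show "open (range S)"
    by (simp add: surj_S)
qed (use mono_S in \<open>auto dest: monoD\<close>)

lemma continuous_funpow_S: "continuous_on UNIV (S ^^ k)"
proof (induction k)
  case (Suc k)
  then show ?case
    using continuous_on_compose2[OF continuous_S, of UNIV "S ^^ k"] by simp
qed (simp add: id_def)

lemma mono_funpow_S: "x \<le> y \<Longrightarrow> (S ^^ k) x \<le> (S ^^ k) y"
  using mono_S by (induction k) (auto dest: monoD)

lemma funpow_S_le: "(S ^^ k) t \<le> t"
  by (induction k) (auto intro: order.trans less_imp_le[OF S_less])

text \<open>A decreasing orbit that stayed bounded below would converge to a fixed point of S, which
  \<open>S_less\<close> excludes.\<close>

lemma filterlim_funpow_S: "filterlim (\<lambda>k. (S ^^ k) t) at_bot sequentially"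
proof -
  have dec: "decseq (\<lambda>k. (S ^^ k) t)"
    by (rule decseq_SucI) (simp add: less_imp_le[OF S_less])
  have "\<exists>k. (S ^^ k) t \<le> Z" for Z
  proof (rule ccontr)
    assume "\<nexists>k. (S ^^ k) t \<le> Z"
    then obtain L where L: "(\<lambda>k. (S ^^ k) t) \<longlonglongrightarrow> L"
      using decseq_convergent[OF dec, of Z] by (metis linorder_le_cases)
    have "(\<lambda>k. S ((S ^^ k) t)) \<longlonglongrightarrow> S L"
      using continuous_on_tendsto_compose[OF continuous_S L] by simp
    moreover have "(\<lambda>k. S ((S ^^ k) t)) \<longlonglongrightarrow> L"
      using LIMSEQ_Suc[OF L] by simp
    ultimately have "S L = L"
      by (rule LIMSEQ_unique)
    with S_less[of L] show False
      by simp
  qed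
  then show ?thesis
    unfolding filterlim_at_bot eventually_sequentially
    using decseqD[OF dec] by (metis order.trans)
qed

section \<open>Series for the gaps to the right of index 0\<close>

text \<open>With $t = t_0$, this is $(m_{k+1} - m_k)/(m_1 - m_0)$.\<close>

definition w :: "nat \<Rightarrow> real \<Rightarrow> real" where
  "w k t = (\<Prod>j<k. \<mu> ((S ^^ Suc j) t) / \<nu> ((S ^^ Suc j) t))"

lemma w_pos: "0 < w k t"
  unfolding w_def by (intro prod_pos ballI divide_pos_pos \<mu>_pos \<nu>_pos)

lemma continuous_w: "continuous_on UNIV (w k)"
proof -
  have "continuous_on UNIV (\<lambda>t. \<mu> ((S ^^ j) t))" "continuous_on UNIV (\<lambda>t. \<nu> ((S ^^ j) t))" for j
    using continuous_on_compose2[OF continuous_\<mu> continuous_funpow_S subset_UNIV]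
      continuous_on_compose2[OF continuous_\<nu> continuous_funpow_S subset_UNIV] by auto
  then show ?thesis
    unfolding w_def using \<nu>_pos by (intro continuous_intros) (auto simp: less_imp_neq[symmetric] simp del: funpow.simps)
qed

text \<open>An upper bound for \<open>\<mu> t / \<nu> t\<close>, obtained by keeping only
  \<open>(1 + \<kappa>) * exp (- \<rho> * t)\<close> in the denominator. It is increasing in t,
  which makes estimates uniform on half-lines, and tends to (1 - \<kappa>)/(1 + \<kappa>) < 1 at
  minus infinity.\<close>

definition ratio_bound :: "real \<Rightarrow> real" where
  "ratio_bound t = ((1 - \<kappa>) + 2 * (1 + \<rho> * \<kappa>) * exp (\<rho> * t) + (1 + \<kappa>) * (exp (\<rho> * t))\<^sup>2) / (1 + \<kappa>)"

lemma ratio_bound_nonneg: "0 \<le> ratio_bound t"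
  unfolding ratio_bound_def using params by (intro divide_nonneg_nonneg add_nonneg_nonneg mult_nonneg_nonneg) auto

lemma ratio_bound_mono: "s \<le> t \<Longrightarrow> ratio_bound s \<le> ratio_bound t"
  unfolding ratio_bound_def using params
  by (intro divide_right_mono add_mono mult_left_mono power_mono) auto

lemma \<mu>_over_\<nu>_le: "\<mu> t / \<nu> t \<le> ratio_bound t"
proof -
  have "0 \<le> 2 * (1 - \<rho> * \<kappa>) + (1 - \<kappa>) * exp (\<rho> * t)"
    using \<rho>\<kappa>_le_1 params by (intro add_nonneg_nonneg mult_nonneg_nonneg) auto
  moreover have "2 * (\<rho> * \<kappa>) * \<nu> t =
      (1 + \<kappa>) * exp (- \<rho> * t) + (2 * (1 - \<rho> * \<kappa>) + (1 - \<kappa>) * exp (\<rho> * t))"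
    unfolding \<nu>_def using params by simp
  ultimately have "(1 + \<kappa>) * exp (- \<rho> * t) \<le> 2 * (\<rho> * \<kappa>) * \<nu> t"
    by simp
  then have "ratio_bound t * ((1 + \<kappa>) * exp (- \<rho> * t)) \<le> ratio_bound t * (2 * (\<rho> * \<kappa>) * \<nu> t)"
    by (rule mult_left_mono[OF _ ratio_bound_nonneg])
  moreover have "ratio_bound t * ((1 + \<kappa>) * exp (- \<rho> * t)) = 2 * (\<rho> * \<kappa>) * \<mu> t"
  proof -
    have "(1 + \<kappa>) * ratio_bound t =
        (1 - \<kappa>) + 2 * (1 + \<rho> * \<kappa>) * exp (\<rho> * t) + (1 + \<kappa>) * (exp (\<rho> * t))\<^sup>2"
      "2 * (\<rho> * \<kappa>) * \<mu> t =
        (1 - \<kappa>) * exp (- \<rho> * t) + 2 * (1 + \<rho> * \<kappa>) + (1 + \<kappa>) * exp (\<rho> * t)"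
      using params by (simp_all add: ratio_bound_def \<mu>_altdef)
    moreover have "exp (- \<rho> * t) * exp (\<rho> * t) = 1"
      by (simp flip: exp_add)
    ultimately show ?thesis
      by algebra
  qed
  ultimately have "2 * (\<rho> * \<kappa>) * \<mu> t \<le> 2 * (\<rho> * \<kappa>) * (ratio_bound t * \<nu> t)"
    by (simp add: mult_ac)
  then have "\<mu> t \<le> ratio_bound t * \<nu> t"
    using \<rho>\<kappa>_pos by (subst (asm) mult_le_cancel_left_pos) auto
  then show ?thesis
    using \<nu>_pos[of t] by (simp add: pos_divide_le_eq)
qed

lemma summable_ratio_bound: "summable (\<lambda>k. \<Prod>j<k. ratio_bound ((S ^^ Suc j) t))"
proof -
  \<comment> \<open>Any number strictly between the limit (1 - \<kappa>)/(1 + \<kappa>) of the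
    ratios and 1 serves in the ratio test.\<close>
  define q where "q = 1 / (1 + \<kappa>)"
  have "(\<lambda>k. exp (\<rho> * (S ^^ Suc k) t)) \<longlonglongrightarrow> 0"
    using filterlim_compose[OF exp_at_bot filterlim_tendsto_pos_mult_at_bot[OF tendsto_const params(3)
          filterlim_compose[OF filterlim_funpow_S filterlim_Suc]]] .
  then have "(\<lambda>k. ratio_bound ((S ^^ Suc k) t)) \<longlonglongrightarrow>
      ((1 - \<kappa>) + 2 * (1 + \<rho> * \<kappa>) * 0 + (1 + \<kappa>) * 0\<^sup>2) / (1 + \<kappa>)"
    unfolding ratio_bound_def using params by (intro tendsto_intros) auto
  then have "(\<lambda>k. ratio_bound ((S ^^ Suc k) t)) \<longlonglongrightarrow> (1 - \<kappa>) / (1 + \<kappa>)"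
    by simp
  moreover have "(1 - \<kappa>) / (1 + \<kappa>) < q"
    unfolding q_def using params by (intro divide_strict_right_mono) auto
  ultimately have "\<forall>\<^sub>F k in sequentially. ratio_bound ((S ^^ Suc k) t) < q"
    by (rule order_tendstoD)
  then obtain N where N: "\<And>k. k \<ge> N \<Longrightarrow> ratio_bound ((S ^^ Suc k) t) < q"
    by (auto simp: eventually_sequentially)
  show ?thesis
  proof (rule summable_ratio_test)
    show "q < 1"
      unfolding q_def using params by simp
    fix k
    assume "k \<ge> N"
    have "0 \<le> (\<Prod>j<k. ratio_bound ((S ^^ Suc j) t))"
      by (intro prod_nonneg ballI ratio_bound_nonneg)
    then have "(\<Prod>j<k. ratio_bound ((S ^^ Suc j) t)) * ratio_bound ((S ^^ Suc k) t) \<le>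
        (\<Prod>j<k. ratio_bound ((S ^^ Suc j) t)) * q"
      using N[OF \<open>k \<ge> N\<close>] by (intro mult_left_mono) auto
    then show "norm (\<Prod>j<Suc k. ratio_bound ((S ^^ Suc j) t)) \<le> q * norm (\<Prod>j<k. ratio_bound ((S ^^ Suc j) t))"
      by (simp add: prod_nonneg ratio_bound_nonneg mult_ac abs_mult abs_prod del: funpow.simps)
  qed
qed

text \<open>Iterates of S and \<open>ratio_bound\<close> are both monotone, so the bound at T
  dominates for all t up to T.\<close>

lemma w_le: "w k t \<le> (\<Prod>j<k. ratio_bound ((S ^^ Suc j) T))" if "t \<le> T"
  unfolding w_def
proof (intro prod_mono conjI)
  fix j
  show "0 \<le> \<mu> ((S ^^ Suc j) t) / \<nu> ((S ^^ Suc j) t)"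
    by (simp add: less_imp_le \<mu>_pos \<nu>_pos)
  show "\<mu> ((S ^^ Suc j) t) / \<nu> ((S ^^ Suc j) t) \<le> ratio_bound ((S ^^ Suc j) T)"
    by (rule order.trans[OF \<mu>_over_\<nu>_le ratio_bound_mono[OF mono_funpow_S[OF that]]])
qed

text \<open>For a solution with t = t_0, this is the sum over k of f(t_k) times the increment
  m_{k+1} - m_k, in units of a_0. The choice f = 1 gives the right-hand gap of m, and f = \<phi>
  that of n.\<close>

definition wsum :: "(real \<Rightarrow> real) \<Rightarrow> real \<Rightarrow> real" where
  "wsum f t = \<mu> t * (\<Sum>k. w k t * f ((S ^^ k) t))"

context
  fixes f :: "real \<Rightarrow> real"
  assumes f: "\<And>x. 0 < f x" "mono f" "continuous_on UNIV f"
begin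

lemma wsum_term_le:
  assumes "t \<le> T"
  shows "norm (w k t * f ((S ^^ k) t)) \<le> (\<Prod>j<k. ratio_bound ((S ^^ Suc j) T)) * f T"
proof -
  have "f ((S ^^ k) t) \<le> f T"
    using f(2) order.trans[OF funpow_S_le assms] by (rule monoD)
  then have "w k t * f ((S ^^ k) t) \<le> (\<Prod>j<k. ratio_bound ((S ^^ Suc j) T)) * f T"
    using w_le[OF assms] w_pos f(1)
    by (intro mult_mono) (simp_all add: prod_nonneg ratio_bound_nonneg less_imp_le del: funpow.simps)
  then show ?thesis
    using w_pos[of k t] f(1) by (simp add: less_imp_le)
qed

lemma summable_wsum: "summable (\<lambda>k. w k t * f ((S ^^ k) t))"
  by (rule summable_comparison_test'[OF summable_mult2[OF summable_ratio_bound]])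
    (rule wsum_term_le[OF order.refl])

lemma wsum_pos: "0 < wsum f t"
proof -
  have "0 < w k t * f ((S ^^ k) t)" for k
    by (rule mult_pos_pos[OF w_pos f(1)])
  then show ?thesis
    unfolding wsum_def by (rule mult_pos_pos[OF \<mu>_pos suminf_pos[OF summable_wsum]])
qed

text \<open>The M-test gives uniform convergence on each half-line below T, and every point is
  interior to one of these.\<close>

lemma continuous_wsum: "continuous_on UNIV (wsum f)"
proof -
  have cont_term: "continuous_on A (\<lambda>t. w k t * f ((S ^^ k) t))" for k A
    by (rule continuous_on_subset[OF continuous_on_mult[OF continuous_w
          continuous_on_compose2[OF f(3) continuous_funpow_S subset_UNIV]] subset_UNIV])
  have cont: "continuous_on {..<T} (\<lambda>t. \<Sum>k. w k t * f ((S ^^ k) t))" for T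
  proof (rule uniform_limit_theorem)
    show "uniform_limit {..<T} (\<lambda>N t. \<Sum>k<N. w k t * f ((S ^^ k) t))
        (\<lambda>t. \<Sum>k. w k t * f ((S ^^ k) t)) sequentially"
      by (rule Weierstrass_m_test[OF _ summable_mult2[OF summable_ratio_bound[of T]]])
        (rule wsum_term_le, simp)
  qed (auto intro!: always_eventually continuous_on_sum cont_term)
  have "isCont (\<lambda>t. \<Sum>k. w k t * f ((S ^^ k) t)) t" for t
    using cont[of "t + 1"] unfolding continuous_on_eq_continuous_at[OF open_lessThan] by simp
  then show ?thesis
    unfolding wsum_def
    by (intro continuous_on_mult continuous_\<mu> continuous_at_imp_continuous_on) auto
qed

end

section \<open>The ratio \<Lambda> of the boundary gaps\<close>

text \<open>The ratio $(n_i - n_{i+1})/(m_{i+1} - m_i)$ as a function of $t_i$; as a function of $t_{i+1}$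
  the same ratio is $\exp\Delta(t_{i+1})$.\<close>

definition \<phi> :: "real \<Rightarrow> real" where
  "\<phi> t = exp (- \<Delta> (- t))"

definition G :: "real \<Rightarrow> real" where
  "G = wsum (\<lambda>_. 1)"

definition H :: "real \<Rightarrow> real" where
  "H = wsum \<phi>"

lemma mono_\<phi>: "mono \<phi>"
  using strict_mono_\<Delta> by (simp add: mono_def \<phi>_def strict_mono_less_eq)

lemma continuous_\<phi>: "continuous_on UNIV \<phi>"
  unfolding \<phi>_def
  by (intro continuous_intros continuous_on_compose2[OF continuous_\<Delta>[of UNIV]]) auto

lemma \<phi>_pos: "0 < \<phi> t"
  by (simp add: \<phi>_def)

lemma \<phi>_eq: "\<phi> t = exp t * \<nu> (- t) / \<mu> t"
proof -
  have "\<phi> t = inverse (exp (\<Delta> (- t)))"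
    by (simp add: \<phi>_def exp_minus)
  then show ?thesis
    unfolding exp_\<Delta> by (simp add: exp_minus divide_inverse mult_ac)
qed

lemmas \<phi>_wsum = \<phi>_pos mono_\<phi> continuous_\<phi>

lemma one_wsum: "0 < (1 :: real)" "mono (\<lambda>_ :: real. 1 :: real)" "continuous_on UNIV (\<lambda>_ :: real. 1 :: real)"
  by (auto simp: mono_def)

lemma G_pos: "0 < G t" and H_pos: "0 < H t"
  unfolding G_def H_def by (intro wsum_pos one_wsum \<phi>_wsum)+

lemma continuous_G: "continuous_on UNIV G" and continuous_H: "continuous_on UNIV H"
  unfolding G_def H_def by (intro continuous_wsum one_wsum \<phi>_wsum)+

text \<open>Numerator and denominator are the full gaps of n and m divided by a_0. The terms at -t
  are the parts left of index 0, read off from the reversed solution; these come in units of b_0 =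
  a_0 exp(t).\<close>

definition \<Lambda> :: "real \<Rightarrow> real" where
  "\<Lambda> t = (H t + exp t * G (- t)) / (G t + exp t * H (- t))"

lemma \<Lambda>_uminus: "\<Lambda> (- t) = inverse (\<Lambda> t)"
proof -
  have "H (- t) + exp (- t) * G t = exp (- t) * (G t + exp t * H (- t))"
    "G (- t) + exp (- t) * H t = exp (- t) * (H t + exp t * G (- t))"
    by (simp_all add: distrib_left flip: mult.assoc exp_add)
  then show ?thesis
    by (simp add: \<Lambda>_def)
qed

lemma \<Lambda>_pos: "0 < \<Lambda> t"
  unfolding \<Lambda>_def by (intro divide_pos_pos add_pos_pos mult_pos_pos G_pos H_pos) auto

lemma continuous_\<Lambda>: "continuous_on A \<Lambda>"
proof -
  have "continuous_on UNIV (\<lambda>t. G (- t))" "continuous_on UNIV (\<lambda>t. H (- t))"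
    by (intro continuous_on_compose2[OF continuous_G] continuous_on_compose2[OF continuous_H]
        continuous_intros; simp)+
  moreover have "0 < G t + exp t * H (- t)" for t
    by (intro add_pos_pos mult_pos_pos G_pos H_pos) auto
  ultimately have "continuous_on UNIV \<Lambda>"
    unfolding \<Lambda>_def using continuous_G continuous_H
    by (intro continuous_intros) (auto simp: less_imp_neq[symmetric])
  then show ?thesis
    by (rule continuous_on_subset) simp
qed

section \<open>Symmetries, recursion and limits of solutions\<close>

text \<open>Reversal turns t_i into -t_{-i}, so limits on the left follow from those on the
  right.\<close>

lemma ABMN_reverse:
  assumes "(a, b, m, n) \<in> ABMN \<kappa> \<rho>"
  shows "(\<lambda>i. b (- i), \<lambda>i. a (- i), \<lambda>i. n (- i), \<lambda>i. m (- i)) \<in> ABMN \<kappa> \<rho>"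
  unfolding ABMN_iff_steps
proof (intro allI)
  fix i
  have s: "0 < a (- i) \<and> 0 < b (- i) \<and>
     m (- i + 1) - m (- i) = a (- i) * \<mu> (ln (b (- i) / a (- i))) \<and>
     m (- i) - m (- i - 1) = a (- i) * \<nu> (ln (b (- i) / a (- i))) \<and>
     n (- i - 1) - n (- i) = b (- i) * \<mu> (- ln (b (- i) / a (- i))) \<and>
     n (- i) - n (- i + 1) = b (- i) * \<nu> (- ln (b (- i) / a (- i)))"
    using assms unfolding ABMN_iff_steps by blast
  then have "ln (a (- i) / b (- i)) = - ln (b (- i) / a (- i))"
    by (simp add: ln_div)
  moreover have "- (i + 1) = - i - 1" "- (i - 1) = - i + 1"
    by simp_all
  ultimately show "0 < b (- i) \<and> 0 < a (- i) \<and>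
     n (- (i + 1)) - n (- i) = b (- i) * \<mu> (ln (a (- i) / b (- i))) \<and>
     n (- i) - n (- (i - 1)) = b (- i) * \<nu> (ln (a (- i) / b (- i))) \<and>
     m (- (i - 1)) - m (- i) = a (- i) * \<mu> (- ln (a (- i) / b (- i))) \<and>
     m (- i) - m (- (i + 1)) = a (- i) * \<nu> (- ln (a (- i) / b (- i)))"
    using s by simp
qed

lemma ABMN_shift:
  assumes "(a, b, m, n) \<in> ABMN \<kappa> \<rho>"
  shows "(\<lambda>i. a (i + 1), \<lambda>i. b (i + 1), \<lambda>i. m (i + 1), \<lambda>i. n (i + 1)) \<in> ABMN \<kappa> \<rho>"
  unfolding ABMN_iff_steps
proof (intro allI)
  fix i
  have "i - 1 + 1 = i + 1 - (1 :: int)"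
    by simp
  then show "0 < a (i + 1) \<and> 0 < b (i + 1) \<and>
     m (i + 1 + 1) - m (i + 1) = a (i + 1) * \<mu> (ln (b (i + 1) / a (i + 1))) \<and>
     m (i + 1) - m (i - 1 + 1) = a (i + 1) * \<nu> (ln (b (i + 1) / a (i + 1))) \<and>
     n (i - 1 + 1) - n (i + 1) = b (i + 1) * \<mu> (- ln (b (i + 1) / a (i + 1))) \<and>
     n (i + 1) - n (i + 1 + 1) = b (i + 1) * \<nu> (- ln (b (i + 1) / a (i + 1)))"
    using assms unfolding ABMN_iff_steps by presburger
qed

lemma ABMN_affine:
  assumes "(a, b, m, n) \<in> ABMN \<kappa> \<rho>" "0 < c"
  shows "(\<lambda>i. c * a i, \<lambda>i. c * b i, \<lambda>i. c * m i + p, \<lambda>i. c * n i + q) \<in> ABMN \<kappa> \<rho>"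
  using assms unfolding ABMN_iff_steps
  by (simp add: mult.assoc flip: right_diff_distrib)

text \<open>The ratio of the two increments across one edge is computed from both of its ends;
  equating the results fixes \<Delta> at t_{i+1}, and \<Delta> is injective.\<close>

lemma ABMN_next:
  assumes "(a, b, m, n) \<in> ABMN \<kappa> \<rho>"
  shows "ln (b (i + 1) / a (i + 1)) = S (ln (b i / a i))"
    and "n i - n (i + 1) = \<phi> (ln (b i / a i)) * (m (i + 1) - m i)"
proof -
  define \<tau> where "\<tau> j = ln (b j / a j)" for j
  have st: "0 < a j" "0 < b j"
     "m (j + 1) - m j = a j * \<mu> (\<tau> j)" "m j - m (j - 1) = a j * \<nu> (\<tau> j)"
     "n (j - 1) - n j = b j * \<mu> (- \<tau> j)" "n j - n (j + 1) = b j * \<nu> (- \<tau> j)" for j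
    using assms unfolding ABMN_iff_steps \<tau>_def by blast+
  have b: "b j = a j * exp (\<tau> j)" for j
    using st(1,2)[of j] by (simp add: \<tau>_def)
  show "n i - n (i + 1) = \<phi> (ln (b i / a i)) * (m (i + 1) - m i)"
    unfolding \<tau>_def[symmetric] st(3,6) \<phi>_eq b using \<mu>_pos[of "\<tau> i"] by simp
  have "exp (\<Delta> (\<tau> (i + 1))) = (n i - n (i + 1)) / (m (i + 1) - m i)"
    using st(4,5)[of "i + 1"] st(1)[of "i + 1"] by (simp add: exp_\<Delta> b)
  also have "\<dots> = \<phi> (\<tau> i)"
    unfolding st(3,6) \<phi>_eq b using st(1)[of i] by simp
  finally have "\<Delta> (\<tau> (i + 1)) = - \<Delta> (- \<tau> i)"
    by (simp add: \<phi>_def)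
  then show "ln (b (i + 1) / a (i + 1)) = S (ln (b i / a i))"
    unfolding \<tau>_def[symmetric] by (rule S_eqI[symmetric])
qed

lemma ABMN_right_limits:
  assumes "(a, b, m, n) \<in> ABMN \<kappa> \<rho>"
  defines "t \<equiv> ln (b 0 / a 0)"
  shows "(\<lambda>k. m (int k)) \<longlonglongrightarrow> m 0 + a 0 * G t" "(\<lambda>k. n (int k)) \<longlonglongrightarrow> n 0 - a 0 * H t"
proof -
  define \<tau> where "\<tau> j = ln (b j / a j)" for j
  have st: "0 < a j" "m (j + 1) - m j = a j * \<mu> (\<tau> j)" "m j - m (j - 1) = a j * \<nu> (\<tau> j)" for j
    using assms unfolding ABMN_iff_steps \<tau>_def by blast+
  have \<tau>: "\<tau> (int k) = (S ^^ k) t" for k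
  proof (induction k)
    case (Suc k)
    have "\<tau> (int k + 1) = S (\<tau> (int k))"
      unfolding \<tau>_def by (rule ABMN_next(1)[OF assms(1)])
    with Suc show ?case
      by (simp add: add.commute)
  qed (simp add: \<tau>_def t_def)
  have mstep: "m (int k + 1) - m (int k) = a 0 * \<mu> t * w k t" for k
  proof (induction k)
    case 0
    show ?case
      using st(2)[of 0] \<tau>[of 0] by (simp add: w_def)
  next
    case (Suc k)
    \<comment> \<open>The increments on both sides of index k + 1 are multiples of the same
      \<open>a\<close> value, which cancels from their quotient.\<close>
    have "m (int (Suc k) + 1) - m (int (Suc k)) = (m (int k + 1) - m (int k)) * (\<mu> (\<tau> (int (Suc k))) / \<nu> (\<tau> (int (Suc k))))"
      using st(2,3)[of "int (Suc k)"] \<nu>_pos[of "\<tau> (int (Suc k))"] by (simp add: add.commute)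
    also have "\<dots> = a 0 * \<mu> t * w (Suc k) t"
      unfolding Suc \<tau> by (simp add: w_def)
    finally show ?case .
  qed
  have nstep: "n (int k) - n (int k + 1) = a 0 * \<mu> t * (w k t * \<phi> ((S ^^ k) t))" for k
    using ABMN_next(2)[OF assms(1), of "int k"] unfolding \<tau>_def[symmetric] \<tau> mstep by simp
  have "m (int k) = m 0 + a 0 * \<mu> t * (\<Sum>j<k. w j t * 1)" for k
  proof (induction k)
    case (Suc k)
    then show ?case
      using mstep[of k] by (simp add: algebra_simps)
  qed simp
  moreover have "(\<lambda>k. m 0 + a 0 * \<mu> t * (\<Sum>j<k. w j t * 1)) \<longlonglongrightarrow> m 0 + a 0 * \<mu> t * (\<Sum>k. w k t * 1)"
    by (intro tendsto_intros summable_LIMSEQ summable_wsum one_wsum)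
  ultimately show "(\<lambda>k. m (int k)) \<longlonglongrightarrow> m 0 + a 0 * G t"
    by (simp add: G_def wsum_def mult.assoc)
  have "n (int k) = n 0 - a 0 * \<mu> t * (\<Sum>j<k. w j t * \<phi> ((S ^^ j) t))" for k
  proof (induction k)
    case (Suc k)
    then show ?case
      using nstep[of k] by (simp add: algebra_simps)
  qed simp
  moreover have "(\<lambda>k. n 0 - a 0 * \<mu> t * (\<Sum>j<k. w j t * \<phi> ((S ^^ j) t))) \<longlonglongrightarrow>
      n 0 - a 0 * \<mu> t * (\<Sum>j. w j t * \<phi> ((S ^^ j) t))"
    by (intro tendsto_intros summable_LIMSEQ summable_wsum \<phi>_wsum)
  ultimately show "(\<lambda>k. n (int k)) \<longlonglongrightarrow> n 0 - a 0 * H t"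
    by (simp add: H_def wsum_def mult.assoc)
qed

lemma ABMN_boundary_data:
  assumes "(a, b, m, n) \<in> ABMN \<kappa> \<rho>"
  defines "t \<equiv> ln (b 0 / a 0)"
  shows "has_boundary_data (a, b, m, n)
    (m 0 - b 0 * H (- t), m 0 + a 0 * G t, n 0 + b 0 * G (- t), n 0 - a 0 * H t)"
proof -
  have "0 < a 0" "0 < b 0"
    using assms unfolding ABMN_iff_steps by blast+
  then have "ln (a 0 / b 0) = - t"
    by (simp add: t_def ln_div)
  then show ?thesis
    using ABMN_right_limits[OF assms(1)] ABMN_right_limits[OF ABMN_reverse[OF assms(1)]]
    by (simp add: has_boundary_data_def t_def)
qed

lemma has_boundary_data_ratio:
  assumes s: "(a, b, m, n) \<in> ABMN \<kappa> \<rho>" "has_boundary_data (a, b, m, n) (m1, m2, n1, n2)"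
  shows "m1 < m2" "(n1 - n2) / (m2 - m1) = \<Lambda> (ln (b 0 / a 0))"
proof -
  define t where "t = ln (b 0 / a 0)"
  have pos: "0 < a 0" "0 < b 0"
    using s(1) unfolding ABMN_iff_steps by blast+
  have lim: "m1 = m 0 - b 0 * H (- t)" "m2 = m 0 + a 0 * G t"
    "n1 = n 0 + b 0 * G (- t)" "n2 = n 0 - a 0 * H t"
    using ABMN_boundary_data[OF s(1)] s(2) unfolding has_boundary_data_def t_def
    by (auto intro: LIMSEQ_unique)
  have b: "b 0 = a 0 * exp t"
    using pos by (simp add: t_def)
  have "m2 - m1 = a 0 * (G t + exp t * H (- t))" "n1 - n2 = a 0 * (H t + exp t * G (- t))"
    unfolding lim b by (simp_all add: algebra_simps)
  moreover have "0 < G t + exp t * H (- t)"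
    by (intro add_pos_pos mult_pos_pos G_pos H_pos) auto
  ultimately have "0 < m2 - m1" "(n1 - n2) / (m2 - m1) = \<Lambda> t"
    using pos by (simp_all add: \<Lambda>_def)
  then show "m1 < m2" "(n1 - n2) / (m2 - m1) = \<Lambda> (ln (b 0 / a 0))"
    by (simp_all add: t_def)
qed

section \<open>Existence of a solution for every t_0\<close>

lemma S_orbit_exists: "\<exists>\<tau> :: int \<Rightarrow> real. \<tau> 0 = t \<and> (\<forall>i. \<tau> (i + 1) = S (\<tau> i))"
proof -
  \<comment> \<open>Negative indices use that the inverse of S is t \<mapsto> -S(-t).\<close>
  define \<tau> where "\<tau> i = (if 0 \<le> i then (S ^^ nat i) t else - (S ^^ nat (- i)) (- t))" for i
  have "\<tau> (i + 1) = S (\<tau> i)" for i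
  proof (cases "0 \<le> i")
    case True
    then show ?thesis
      by (simp add: \<tau>_def nat_add_distrib)
  next
    case False
    then have "i = - int (Suc (nat (- i) - 1))"
      by simp
    then obtain k where "i = - int (Suc k)" ..
    \<comment> \<open>The case k = 0 is separate because i + 1 = 0 then falls under the first branch
      of \<open>\<tau>\<close>.\<close>
    then show ?thesis
      by (cases k) (simp_all add: \<tau>_def S_uminus_S nat_add_distrib)
  qed
  moreover have "\<tau> 0 = t"
    by (simp add: \<tau>_def)
  ultimately show ?thesis
    by blast
qed

text \<open>Along an orbit of S, the values of a are forced by agreement of the two expressions for
  each increment of m. The corresponding agreement for n then holds by the defining equation of
  S.\<close>

lemma ABMN_exists: "\<exists>a b m n. (a, b, m, n) \<in> ABMN \<kappa> \<rho> \<and> ln (b 0 / a 0) = t"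
proof -
  obtain \<tau> :: "int \<Rightarrow> real" where \<tau>: "\<tau> 0 = t" "\<And>i. \<tau> (i + 1) = S (\<tau> i)"
    using S_orbit_exists[of t] by blast
  \<comment> \<open>L is ln a; its increments encode a_{i+1} \<nu>(t_{i+1}) = a_i
    \<mu>(t_i).\<close>
  obtain L where L: "\<And>i. L (i + 1) - L i = ln (\<mu> (\<tau> i) / \<nu> (\<tau> (i + 1)))"
    using antidifference_exists[of "\<lambda>i. ln (\<mu> (\<tau> i) / \<nu> (\<tau> (i + 1)))"] by blast
  define a b where "a i = exp (L i)" and "b i = exp (L i) * exp (\<tau> i)" for i
  have ln: "ln (b i / a i) = \<tau> i" for i
    by (simp add: a_def b_def)
  have a: "a (i + 1) * \<nu> (\<tau> (i + 1)) = a i * \<mu> (\<tau> i)" for i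
  proof -
    have "exp (L (i + 1)) = exp (L i) * exp (L (i + 1) - L i)"
      by (simp flip: exp_add)
    then show ?thesis
      using \<mu>_pos[of "\<tau> i"] \<nu>_pos[of "\<tau> (i + 1)"] by (simp add: a_def L)
  qed
  have b: "b (i + 1) * \<mu> (- \<tau> (i + 1)) = b i * \<nu> (- \<tau> i)" for i
  proof -
    have "b (i + 1) * \<mu> (- \<tau> (i + 1)) = a (i + 1) * \<nu> (\<tau> (i + 1)) * exp (\<Delta> (\<tau> (i + 1)))"
      using \<nu>_pos[of "\<tau> (i + 1)"] by (simp add: exp_\<Delta> a_def b_def)
    also have "\<dots> = a i * \<mu> (\<tau> i) * \<phi> (\<tau> i)"
      unfolding a unfolding \<tau>(2) \<Delta>_S \<phi>_def ..
    also have "\<dots> = b i * \<nu> (- \<tau> i)"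
      using \<mu>_pos[of "\<tau> i"] by (simp add: \<phi>_eq a_def b_def)
    finally show ?thesis .
  qed
  obtain m where m: "\<And>i. m (i + 1) - m i = a i * \<mu> (\<tau> i)"
    using antidifference_exists[of "\<lambda>i. a i * \<mu> (\<tau> i)"] by blast
  obtain n where n: "\<And>i. n (i + 1) - n i = - (b i * \<nu> (- \<tau> i))"
    using antidifference_exists[of "\<lambda>i. - (b i * \<nu> (- \<tau> i))"] by blast
  have "(a, b, m, n) \<in> ABMN \<kappa> \<rho>"
    unfolding ABMN_iff_steps ln
  proof (intro allI conjI)
    fix i
    show "0 < a i" "0 < b i"
      by (simp_all add: a_def b_def)
    show "m (i + 1) - m i = a i * \<mu> (\<tau> i)" "n i - n (i + 1) = b i * \<nu> (- \<tau> i)"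
      using m n[of i] by simp_all
    show "m i - m (i - 1) = a i * \<nu> (\<tau> i)" "n (i - 1) - n i = b i * \<mu> (- \<tau> i)"
      using m[of "i - 1"] n[of "i - 1"] a[of "i - 1"] b[of "i - 1"] by simp_all
  qed
  then show ?thesis
    using ln[of 0] \<tau>(1) by (intro exI[of _ a] exI[of _ b] exI[of _ m] exI[of _ n]) simp
qed

section \<open>Invariance and range of \<Lambda>\<close>

text \<open>No series are manipulated: shifting a solution by one index keeps its boundary data and
  replaces t_0 by S(t_0).\<close>

lemma \<Lambda>_S: "\<Lambda> (S t) = \<Lambda> t"
proof -
  obtain a b m n where s: "(a, b, m, n) \<in> ABMN \<kappa> \<rho>" "ln (b 0 / a 0) = t"
    using ABMN_exists by blast
  obtain m1 m2 n1 n2 where bd: "has_boundary_data (a, b, m, n) (m1, m2, n1, n2)"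
    using ABMN_boundary_data[OF s(1)] by blast
  have "(\<lambda>k. f (- int k + 1)) \<longlonglongrightarrow> l1" "(\<lambda>k. f (int k + 1)) \<longlonglongrightarrow> l2"
    if "(\<lambda>k. f (- int k)) \<longlonglongrightarrow> l1" "(\<lambda>k. f (int k)) \<longlonglongrightarrow> l2" for f :: "int \<Rightarrow> real" and l1 l2
    using LIMSEQ_imp_Suc[of "\<lambda>k. f (- int k + 1)" l1] LIMSEQ_Suc[OF that(2)] that(1)
    by (simp_all add: add.commute)
  then have "has_boundary_data (\<lambda>i. a (i + 1), \<lambda>i. b (i + 1), \<lambda>i. m (i + 1), \<lambda>i. n (i + 1)) (m1, m2, n1, n2)"
    using bd by (auto simp: has_boundary_data_def)
  from has_boundary_data_ratio(2)[OF ABMN_shift[OF s(1)] this] has_boundary_data_ratio(2)[OF s(1) bd]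
  show ?thesis
    using ABMN_next(1)[OF s(1), of 0] s(2) by simp
qed

lemma \<Lambda>_funpow_S: "\<Lambda> ((S ^^ k) t) = \<Lambda> t"
  by (induction k) (simp_all add: \<Lambda>_S)

text \<open>The first nonpositive iterate works: if it has a predecessor, that one is positive, so
  monotonicity of S keeps its image above S(0).\<close>

lemma S_orbit_hits_fundamental_interval:
  assumes "0 \<le> t"
  shows "\<exists>k. (S ^^ k) t \<in> {S 0..0}"
proof -
  have "\<exists>k. (S ^^ k) t \<le> 0"
    using filterlim_funpow_S[of t] unfolding filterlim_at_bot eventually_sequentially by blast
  then have l: "(S ^^ (LEAST k. (S ^^ k) t \<le> 0)) t \<le> 0"
    by (rule LeastI_ex)
  moreover have "S 0 \<le> (S ^^ (LEAST k. (S ^^ k) t \<le> 0)) t"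
  proof (cases "LEAST k. (S ^^ k) t \<le> 0")
    case 0
    then show ?thesis
      using assms S_less[of 0] by simp
  next
    case (Suc k)
    then have "\<not> (S ^^ k) t \<le> 0"
      by (metis lessI not_less_Least)
    then show ?thesis
      using monoD[OF mono_S, of 0 "(S ^^ k) t"] Suc by simp
  qed
  ultimately show ?thesis
    by auto
qed

lemma range_\<Lambda>_eq_image: "range \<Lambda> = \<Lambda> ` {S 0..- S 0}"
proof -
  have "\<Lambda> t \<in> \<Lambda> ` {S 0..- S 0}" for t
  proof (cases "0 \<le> t")
    case True
    then obtain k where "(S ^^ k) t \<in> {S 0..0}"
      using S_orbit_hits_fundamental_interval by blast
    then have "(S ^^ k) t \<in> {S 0..- S 0}"
      using S_less[of 0] by auto
    then show ?thesis
      by (metis \<Lambda>_funpow_S image_eqI)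
  next
    case False
    then obtain k where "(S ^^ k) (- t) \<in> {S 0..0}"
      using S_orbit_hits_fundamental_interval[of "- t"] by auto
    then have "- (S ^^ k) (- t) \<in> {S 0..- S 0}"
      using S_less[of 0] by auto
    moreover have "\<Lambda> (- (S ^^ k) (- t)) = \<Lambda> t"
      by (simp add: \<Lambda>_uminus \<Lambda>_funpow_S)
    ultimately show ?thesis
      by (metis image_eqI)
  qed
  then show ?thesis
    by auto
qed

text \<open>The image of a compact interval is a compact interval. Being closed under inversion, it
  has mutually inverse endpoints, and their order gives d \<ge> 1.\<close>

lemma range_\<Lambda>: "\<exists>d\<ge>1. range \<Lambda> = {inverse d..d}"
proof -
  have "S 0 \<le> - S 0"
    using S_less[of 0] by simp
  then obtain c d where cd: "range \<Lambda> = {c..d}" "c \<le> d"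
    unfolding range_\<Lambda>_eq_image using continuous_image_closed_interval[OF _ continuous_\<Lambda>] by metis
  have inv: "inverse x \<in> {c..d} \<and> 0 < x" if x: "x \<in> {c..d}" for x
  proof -
    obtain t where "x = \<Lambda> t"
      using x unfolding cd(1)[symmetric] by blast
    then show ?thesis
      unfolding cd(1)[symmetric] by (simp add: \<Lambda>_pos flip: \<Lambda>_uminus)
  qed
  have pos: "0 < c" "0 < d"
    using inv[of c] inv[of d] cd(2) by auto
  have "c \<le> inverse d" "inverse c \<le> d"
    using inv[of d] inv[of c] cd(2) by auto
  then have c: "c = inverse d"
    using pos le_imp_inverse_le[of "inverse c" d] by simp
  have "1 \<le> d"
  proof (rule ccontr)
    assume "\<not> 1 \<le> d"
    then have "1 < inverse d"
      using pos by (simp add: one_less_inverse)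
    with \<open>\<not> 1 \<le> d\<close> cd(2) c show False
      by simp
  qed
  with cd(1) c show ?thesis
    by blast
qed

section \<open>Boundary data and \<open>lambda_max\<close>\<close>

lemma boundary_ratios:
  "{ereal ((n1 - n2) / (m2 - m1)) | s m1 m2 n1 n2.
      s \<in> ABMN \<kappa> \<rho> \<and> has_boundary_data s (m1, m2, n1, n2)} = ereal ` range \<Lambda>" (is "?R = _")
proof (intro equalityI subsetI)
  fix x
  assume "x \<in> ?R"
  then obtain a b m n m1 m2 n1 n2 where s: "(a, b, m, n) \<in> ABMN \<kappa> \<rho>"
      "has_boundary_data (a, b, m, n) (m1, m2, n1, n2)" and x: "x = ereal ((n1 - n2) / (m2 - m1))"
    by auto
  show "x \<in> ereal ` range \<Lambda>"
    unfolding x has_boundary_data_ratio(2)[OF s] by simp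
next
  fix x
  assume "x \<in> ereal ` range \<Lambda>"
  then obtain t where x: "x = ereal (\<Lambda> t)"
    by blast
  obtain a b m n where s: "(a, b, m, n) \<in> ABMN \<kappa> \<rho>" "ln (b 0 / a 0) = t"
    using ABMN_exists by blast
  obtain m1 m2 n1 n2 where bd: "has_boundary_data (a, b, m, n) (m1, m2, n1, n2)"
    using ABMN_boundary_data[OF s(1)] by blast
  show "x \<in> ?R"
    unfolding x s(2)[symmetric] has_boundary_data_ratio(2)[OF s(1) bd, symmetric]
    using s(1) bd by blast
qed

text \<open>Conversely, a solution with the right ratio is adjusted: scaling matches the gap of m,
  and thereby that of n, and two translations match the left limits.\<close>

lemma boundary_data_exists_iff:
  assumes "m1 < m2"
  shows "(\<exists>s \<in> ABMN \<kappa> \<rho>. has_boundary_data s (m1, m2, n1, n2)) \<longleftrightarrow> (n1 - n2) / (m2 - m1) \<in> range \<Lambda>"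
proof
  assume "\<exists>s \<in> ABMN \<kappa> \<rho>. has_boundary_data s (m1, m2, n1, n2)"
  then obtain a b m n where "(a, b, m, n) \<in> ABMN \<kappa> \<rho>" "has_boundary_data (a, b, m, n) (m1, m2, n1, n2)"
    by auto
  then show "(n1 - n2) / (m2 - m1) \<in> range \<Lambda>"
    by (simp add: has_boundary_data_ratio(2))
next
  assume "(n1 - n2) / (m2 - m1) \<in> range \<Lambda>"
  then obtain t where t: "(n1 - n2) / (m2 - m1) = \<Lambda> t"
    by blast
  obtain a b m n where s: "(a, b, m, n) \<in> ABMN \<kappa> \<rho>" "ln (b 0 / a 0) = t"
    using ABMN_exists by blast
  obtain M1 M2 N1 N2 where bd: "has_boundary_data (a, b, m, n) (M1, M2, N1, N2)"
    using ABMN_boundary_data[OF s(1)] by blast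
  note M = has_boundary_data_ratio[OF s(1) bd]
  define c where "c = (m2 - m1) / (M2 - M1)"
  have "0 < c"
    using assms M(1) by (simp add: c_def)
  have c: "c * (M2 - M1) = m2 - m1"
    using M(1) by (simp add: c_def)
  have "N1 - N2 = \<Lambda> t * (M2 - M1)" "n1 - n2 = \<Lambda> t * (m2 - m1)"
    using assms M t s(2) by (simp_all add: nonzero_divide_eq_eq)
  with c have "c * (N1 - N2) = n1 - n2"
    by (metis mult.left_commute)
  define p q where "p = m1 - c * M1" and "q = n1 - c * N1"
  have eqs: "c * M1 + p = m1" "c * M2 + p = m2" "c * N1 + q = n1" "c * N2 + q = n2"
    using c \<open>c * (N1 - N2) = n1 - n2\<close> by (simp_all add: p_def q_def algebra_simps)
  have "has_boundary_data (\<lambda>i. c * a i, \<lambda>i. c * b i, \<lambda>i. c * m i + p, \<lambda>i. c * n i + q)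
      (c * M1 + p, c * M2 + p, c * N1 + q, c * N2 + q)"
    using bd by (auto simp: has_boundary_data_def intro!: tendsto_intros)
  with ABMN_affine[OF s(1) \<open>0 < c\<close>, of p q]
  show "\<exists>s \<in> ABMN \<kappa> \<rho>. has_boundary_data s (m1, m2, n1, n2)"
    unfolding eqs by blast
qed

text \<open>The supremum is attained, since d lies in its own interval \<open>{inverse d..d}\<close>
  when d \<ge> 1.\<close>

lemma lambda_max_eq: "\<exists>d\<ge>1. lambda_max \<kappa> \<rho> = ereal d \<and> range \<Lambda> = {inverse d..d}"
proof -
  obtain d where d: "1 \<le> d" "range \<Lambda> = {inverse d..d}"
    using range_\<Lambda> by blast
  then have "d \<in> range \<Lambda>"
    by (simp add: inverse_le_1_iff order.trans[of _ 1])
  then have "lambda_max \<kappa> \<rho> = ereal d"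
    unfolding lambda_max_def boundary_ratios using d(2)
    by (intro antisym Sup_least Sup_upper) auto
  with d show ?thesis
    by blast
qed

end

theorem theorem1p6:
  shows "(\<forall>(\<kappa>, \<rho>) \<in> W_region. lambda_max \<kappa> \<rho> \<in> {1..<\<infinity>}) \<and>
    (\<forall>(\<kappa>, \<rho>) \<in> W_region. \<forall>(m_minus::real) (m_plus::real) (n_minus::real) (n_plus::real).
      m_minus < m_plus \<longrightarrow> n_plus < n_minus \<longrightarrow>
      ((\<exists>s \<in> ABMN \<kappa> \<rho>. has_boundary_data s (m_minus, m_plus, n_minus, n_plus)) \<longleftrightarrow>
       ereal ((n_minus - n_plus) / (m_plus - m_minus))
         \<in> {inverse (lambda_max \<kappa> \<rho>)..lambda_max \<kappa> \<rho>}))"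
proof (intro conjI ballI, goal_cases)
  case (1 p)
  then obtain \<kappa> \<rho> where p: "p = (\<kappa>, \<rho>)" "abmn \<kappa> \<rho>"
    by (cases p) (auto simp: abmn_def)
  then show ?case
    using abmn.lambda_max_eq[OF p(2)] by (auto simp: one_ereal_def)
next
  case (2 p)
  then obtain \<kappa> \<rho> where p: "p = (\<kappa>, \<rho>)" "abmn \<kappa> \<rho>"
    by (cases p) (auto simp: abmn_def)
  obtain d where d: "1 \<le> d" "lambda_max \<kappa> \<rho> = ereal d" "range (abmn.\<Lambda> \<kappa> \<rho>) = {inverse d..d}"
    using abmn.lambda_max_eq[OF p(2)] by blast
  \<comment> \<open>As d is nonzero, \<open>inverse (ereal d)\<close> is
    \<open>ereal (inverse d)\<close>, so membership in the extended-real interval reduces to the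
    real one.\<close>
  then show ?case
    unfolding p(1) using abmn.boundary_data_exists_iff[OF p(2)] by auto
qed

end
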